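(* Let $k$ be a field with $\operatorname{char}k\neq2$ and $M\supseteq k$ an infinite field. For $a,c,a',c'\in M$ with $aa'cc'(c^2+4)(c'^2+4)\neq0$, assume that $c\neq\pm c'$ and $c\neq\pm4/c'$. Then the splitting fields over $M$ of $f_{a,c}(X)=X^4+aX^2+\dfrac{a^2}{c^2+4}$ and of $f_{a',c'}(X)=X^4+a'X^2+\dfrac{a'^2}{c'^2+4}$ coincide if and only if at least one of the polynomials $$F^{\pm}(X)=X^4-aa'X^2+\frac{a^2a'^2(c\pm c')^2}{(c^2+4)(c'^2+4)}$$ has a linear factor over $M$. *)

theory Defs
  imports "HOL-Algebra.Algebraic_Closure_Type" "HOL-Algebra.Generated_Fields"
begin

text \<open>
  Splitting fields are formed inside the fixed algebraic closure \<^typ>\<open>'m alg_closure\<close> of the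
  base field \<^typ>\<open>'m\<close>, which embeds via \<^const>\<open>to_ac\<close>: adjoin all roots of the polynomial to the
  image of the base field. That two splitting fields coincide means that they are equal as subsets
  of this closure.
\<close>

definition splitting_field :: "'m::field poly \<Rightarrow> 'm alg_closure set" where
  "splitting_field p =
     generate_field ring_of_type_algebra (range to_ac \<union> {x. poly (map_poly to_ac p) x = 0})"

definition quartic_f :: "'m::field \<Rightarrow> 'm \<Rightarrow> 'm poly" where
  "quartic_f a c = [: a\<^sup>2 / (c\<^sup>2 + 4), 0, a, 0, 1 :]"

definition F_plus :: "'m::field \<Rightarrow> 'm \<Rightarrow> 'm \<Rightarrow> 'm \<Rightarrow> 'm poly" where
  "F_plus a c a' c' =
     [: a\<^sup>2 * a'\<^sup>2 * (c + c')\<^sup>2 / ((c\<^sup>2 + 4) * (c'\<^sup>2 + 4)), 0, - (a * a'), 0, 1 :]"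

definition F_minus :: "'m::field \<Rightarrow> 'm \<Rightarrow> 'm \<Rightarrow> 'm \<Rightarrow> 'm poly" where
  "F_minus a c a' c' =
     [: a\<^sup>2 * a'\<^sup>2 * (c - c')\<^sup>2 / ((c\<^sup>2 + 4) * (c'\<^sup>2 + 4)), 0, - (a * a'), 0, 1 :]"

definition has_linear_factor :: "'m::field poly \<Rightarrow> bool" where
  "has_linear_factor p \<longleftrightarrow> (\<exists>q. Polynomial.degree q = 1 \<and> q dvd p)"

end

theory Submission
  imports Defs
begin

text \<open>
  With \<open>s\<^sup>2 = c\<^sup>2 + 4\<close>, the roots of \<open>f\<close> are \<open>\<plusminus>x\<close>, \<open>\<plusminus>y\<close>, where \<open>x y s = a\<close>, and the splitting field is
  \<open>M(s)(x)\<close>, cyclic over \<open>M\<close>; a generator of the Galois group acts by \<open>s \<mapsto> -s\<close>, \<open>x \<mapsto> y \<mapsto> -x\<close> when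
  \<open>s \<notin> M\<close>. For a second quartic with data \<open>s'\<close>, \<open>x'\<close>, \<open>y'\<close>, the roots of \<open>F\<^sup>+\<close> are \<open>\<plusminus>(x x' - y y')\<close>,
  \<open>\<plusminus>(x y' + y x')\<close> and those of \<open>F\<^sup>-\<close> are \<open>\<plusminus>(x x' + y y')\<close>, \<open>\<plusminus>(x y' - y x')\<close>.

  If \<open>g = x x' - y y'\<close> lies in \<open>M\<close>, then so does \<open>s s'\<close>, as it can be solved for in terms of \<open>g\<^sup>2\<close>, and
  \<open>g x' = x x'\<^sup>2 - y x' y'\<close> shows that \<open>x'\<close> lies in \<open>M(s)(x)\<close>; the other three roots reduce to this one by
  changing the choice of roots and the sign of \<open>c'\<close>. Conversely, if the splitting fields agree, Kummer
  theory for square roots gives \<open>s' = r s\<close> and \<open>x' = q x\<close> with \<open>r \<in> M\<close>, \<open>q \<in> M(s)\<close>. Conjugating,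
  \<open>y' = \<plusminus>q' y\<close> for the conjugate \<open>q'\<close> of \<open>q\<close>, so \<open>x x' \<plusminus> y y'\<close> is a trace from \<open>M(s)\<close> to \<open>M\<close>. The case
  \<open>s \<in> M\<close> is similar but simpler.
\<close>

section \<open>Subfields as subsets closed under the field operations\<close>

locale closed_subfield =
  fixes L :: "'a::field set"
  assumes one_in: "1 \<in> L"
    and add_in: "u \<in> L \<Longrightarrow> v \<in> L \<Longrightarrow> u + v \<in> L"
    and uminus_in: "u \<in> L \<Longrightarrow> - u \<in> L"
    and mult_in: "u \<in> L \<Longrightarrow> v \<in> L \<Longrightarrow> u * v \<in> L"
    and inverse_in: "u \<in> L \<Longrightarrow> inverse u \<in> L"
begin

lemma zero_in: "0 \<in> L"
  using add_in[OF one_in uminus_in[OF one_in]] by simp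

lemma diff_in: "u \<in> L \<Longrightarrow> v \<in> L \<Longrightarrow> u - v \<in> L"
  using add_in[OF _ uminus_in] by fastforce

lemma divide_in: "u \<in> L \<Longrightarrow> v \<in> L \<Longrightarrow> u / v \<in> L"
  by (simp add: divide_inverse mult_in inverse_in)

lemma power_in: "u \<in> L \<Longrightarrow> u ^ n \<in> L"
  by (induction n) (auto intro: one_in mult_in)

lemma of_nat_in: "of_nat n \<in> L"
  by (induction n) (auto intro: zero_in one_in add_in)

lemma numeral_in: "numeral k \<in> L"
  using of_nat_in[of "numeral k"] by simp

lemmas closed_in = zero_in one_in numeral_in add_in uminus_in diff_in mult_in inverse_in divide_in power_in

lemma uminus_in_iff: "- u \<in> L \<longleftrightarrow> u \<in> L"
  using uminus_in[of u] uminus_in[of "- u"] by auto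

lemma mult_in_cancel: "d * z \<in> L \<Longrightarrow> d \<in> L \<Longrightarrow> d \<noteq> 0 \<Longrightarrow> z \<in> L"
  using divide_in[of "d * z" d] by simp

end

text \<open>Characterises the record-based generated field by closure under the type class
  operations: the generated set is itself closed, so minimality of \<open>K\<close> gives one
  inclusion, and induction on generation gives the other.\<close>

lemma generate_field_eqI:
  fixes H K :: "'a::field set"
  assumes "closed_subfield K" "H \<subseteq> K"
    and least: "\<And>E. closed_subfield E \<Longrightarrow> H \<subseteq> E \<Longrightarrow> K \<subseteq> E"
  shows "generate_field ring_of_type_algebra H = K"
proof -
  interpret K: closed_subfield K by fact
  let ?R = "ring_of_type_algebra :: 'a ring"
  interpret R: field ?R by (rule field_from_type_algebra)
  have ops: "\<one>\<^bsub>?R\<^esub> = 1" "\<zero>\<^bsub>?R\<^esub> = 0" "u \<oplus>\<^bsub>?R\<^esub> v = u + v" "u \<otimes>\<^bsub>?R\<^esub> v = u * v"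
    "carrier ?R = UNIV" for u v
    by (simp_all add: ring_of_type_algebra_def)
  have ainv: "\<ominus>\<^bsub>?R\<^esub> u = - u" for u
    using R.minus_equality[of "-u" u] by (simp add: ops)
  have minv: "inv\<^bsub>?R\<^esub> u = inverse u" if "u \<noteq> 0" for u
    using R.comm_inv_char[of u "inverse u"] that by (simp add: ops)
  let ?G = "generate_field ?R H"
  have "inverse u \<in> ?G" if "u \<in> ?G" for u
    using that generate_field.m_inv[OF that] by (cases "u = 0") (auto simp: ops minv)
  then have "closed_subfield ?G"
    using generate_field.one[of ?R H] generate_field.eng_add[of _ ?R H] generate_field.a_inv[of _ ?R H]
      generate_field.eng_mult[of _ ?R H]
    by unfold_locales (simp_all add: ops ainv)
  then have "K \<subseteq> ?G"
    by (intro least) (auto intro: generate_field.incl)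
  moreover have "u \<in> K" if "u \<in> ?G" for u
    using that
  proof (induction rule: generate_field.induct)
    case (m_inv h)
    then show ?case by (simp add: ops minv K.closed_in)
  qed (use \<open>H \<subseteq> K\<close> in \<open>auto simp: ops ainv intro: K.closed_in\<close>)
  ultimately show ?thesis by blast
qed

section \<open>Adjoining a square root\<close>

definition adjoin_sqrt :: "'a::field set \<Rightarrow> 'a \<Rightarrow> 'a set" where
  "adjoin_sqrt L t = {p + q * t |p q. p \<in> L \<and> q \<in> L}"

context closed_subfield
begin

lemma subset_adjoin_sqrt: "L \<subseteq> adjoin_sqrt L t"
proof
  fix p assume "p \<in> L"
  then have "p = p + 0 * t" "p \<in> L" "0 \<in> L" by (auto intro: zero_in)
  then show "p \<in> adjoin_sqrt L t" unfolding adjoin_sqrt_def by blast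
qed

lemma self_in_adjoin_sqrt: "t \<in> adjoin_sqrt L t"
proof -
  have "t = 0 + 1 * t" by simp
  then show ?thesis unfolding adjoin_sqrt_def using zero_in one_in by blast
qed

lemma adjoin_sqrt_least:
  assumes "closed_subfield E" "L \<subseteq> E" "t \<in> E"
  shows "adjoin_sqrt L t \<subseteq> E"
proof -
  interpret E: closed_subfield E by fact
  show ?thesis using assms(2,3) by (auto simp: adjoin_sqrt_def intro!: E.closed_in)
qed

lemma adjoin_sqrt_trivial: "t \<in> L \<Longrightarrow> adjoin_sqrt L t = L"
  using subset_adjoin_sqrt[of t] adjoin_sqrt_least[of L t] closed_subfield_axioms by blast

lemma adjoin_sqrt_unique:
  assumes "t \<notin> L" "p \<in> L" "q \<in> L" "p' \<in> L" "q' \<in> L" "p + q * t = p' + q' * t"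
  shows "p = p' \<and> q = q'"
proof -
  (* The plain method name denotes a different method from HOL-Algebra. *)
  have "(q - q') * t = p' - p" using assms(6) by Groebner_Basis.algebra
  then have "q - q' = 0"
    using assms mult_in_cancel[of "q - q'" t] diff_in by metis
  then show ?thesis using assms(6) by simp
qed

text \<open>The inverse of \<open>p + q t\<close> is its conjugate divided by the norm
  \<open>p^2 - q^2 t^2\<close>. The case \<open>t \<in> L\<close> is separate because there the
  conjugate of a nonzero element can vanish.\<close>

lemma closed_subfield_adjoin_sqrt:
  assumes t2: "t\<^sup>2 \<in> L"
  shows "closed_subfield (adjoin_sqrt L t)"
proof
  let ?K = "adjoin_sqrt L t"
  have I: "z \<in> ?K" if "z = p + q * t" "p \<in> L" "q \<in> L" for z p q
    using that unfolding adjoin_sqrt_def by blast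
  show "1 \<in> ?K" using subset_adjoin_sqrt one_in by blast
  fix u assume "u \<in> ?K"
  then obtain p q where u: "u = p + q * t" "p \<in> L" "q \<in> L"
    unfolding adjoin_sqrt_def by blast
  show "- u \<in> ?K" by (rule I[of _ "- p" "- q"]) (use u uminus_in in auto)
  show "inverse u \<in> ?K"
  proof (cases "t \<in> L")
    case True
    then have "u \<in> L" using u by (simp add: closed_in)
    then show ?thesis using inverse_in subset_adjoin_sqrt by blast
  next
    case False
    show ?thesis
    proof (cases "u = 0")
      case True
      then show ?thesis using zero_in subset_adjoin_sqrt by auto
    next
      case ne: False
      have "p - q * t \<noteq> 0"
      proof
        assume "p - q * t = 0"
        then have "p + (- q) * t = 0 + 0 * t" by simp
        then have "p = 0 \<and> - q = 0"
          by (intro adjoin_sqrt_unique) (use False u closed_in in auto)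
        then show False using ne u by simp
      qed
      then have N: "p\<^sup>2 - q\<^sup>2 * t\<^sup>2 \<noteq> 0" (is "?N \<noteq> 0")
        using ne u by (metis mult_eq_0_iff power_mult_distrib square_diff_square_factored power2_eq_square)
      have "u * (p / ?N + (- q / ?N) * t) = 1"
        using N unfolding u(1) by (simp add: divide_simps) Groebner_Basis.algebra
      then have "inverse u = p / ?N + (- q / ?N) * t"
        by (rule inverse_unique)
      then show ?thesis by (rule I) (use u t2 in \<open>auto intro!: closed_in\<close>)
    qed
  qed
  fix v assume "v \<in> ?K"
  then obtain p' q' where v: "v = p' + q' * t" "p' \<in> L" "q' \<in> L"
    unfolding adjoin_sqrt_def by blast
  show "u + v \<in> ?K"
    by (rule I[of _ "p + p'" "q + q'"]) (use u v add_in in \<open>auto simp: algebra_simps\<close>)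
  show "u * v \<in> ?K"
    by (rule I[of _ "p * p' + q * q' * t\<^sup>2" "p * q' + q * p'"])
      (use u v t2 in \<open>auto simp: algebra_simps power2_eq_square intro!: closed_in\<close>)
qed

text \<open>The coefficient of \<open>t\<close> in \<open>(p + q t)^2\<close> is
  \<open>2 p q\<close>, which must vanish; \<open>q = 0\<close> would put \<open>z\<close> into
  \<open>L\<close>, so \<open>p = 0\<close>.\<close>

lemma kummer_sqrt:
  assumes two: "(2::'a) \<noteq> 0" and t: "t\<^sup>2 \<in> L" "t \<notin> L" 
    and z: "z \<in> adjoin_sqrt L t" "z\<^sup>2 \<in> L" "z \<notin> L"
  shows "\<exists>q\<in>L. q \<noteq> 0 \<and> z = q * t"
proof -
  obtain p q where pq: "z = p + q * t" "p \<in> L" "q \<in> L"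
    using z(1) unfolding adjoin_sqrt_def by blast
  have "(p\<^sup>2 + q\<^sup>2 * t\<^sup>2) + (2 * p * q) * t = z\<^sup>2 + 0 * t"
    unfolding pq(1) by Groebner_Basis.algebra
  then have "2 * p * q = 0"
    using adjoin_sqrt_unique[OF t(2), of "p\<^sup>2 + q\<^sup>2 * t\<^sup>2" "2 * p * q" "z\<^sup>2" 0] pq t z
    by (auto simp: closed_in)
  moreover have "q \<noteq> 0" using pq z(3) by auto
  ultimately show ?thesis using pq two by auto
qed

end

section \<open>The splitting field of one quartic\<close>

definition root_field :: "'a::field set \<Rightarrow> 'a \<Rightarrow> 'a \<Rightarrow> 'a set" where
  "root_field L s x = adjoin_sqrt (adjoin_sqrt L s) x"

text \<open>The roots of \<open>f\<close> are \<plusminus>\<open>x\<close>,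
  \<plusminus>\<open>y\<close>. Once \<open>s\<close> is chosen, \<open>sq_diff\<close>, which
  follows from the other equations only up to sign, fixes which pair is called \<open>x\<close>, and
  \<open>xys\<close> fixes the sign of \<open>y\<close>.\<close>

locale quartic_roots = closed_subfield L for L :: "'a::field set" +
  fixes a c s x y :: 'a
  assumes two: "(2::'a) \<noteq> 0"
    and a_in: "a \<in> L" and c_in: "c \<in> L"
    and nonzero: "a \<noteq> 0" "c \<noteq> 0"
    and s_sq: "s\<^sup>2 = c\<^sup>2 + 4"
    and xys: "x * y * s = a"
    and sq_add: "x\<^sup>2 + y\<^sup>2 = - a"
    and sq_diff: "(x\<^sup>2 - y\<^sup>2) * s = a * c"
begin

lemma nonzero_roots: "s \<noteq> 0" "x \<noteq> 0" "y \<noteq> 0"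
  using xys nonzero by auto

lemma s_sq_in: "s\<^sup>2 \<in> L"
  unfolding s_sq by (intro closed_in c_in)

sublocale S: closed_subfield "adjoin_sqrt L s"
  by (rule closed_subfield_adjoin_sqrt[OF s_sq_in])

lemma L_subset_S: "L \<subseteq> adjoin_sqrt L s"
  by (rule subset_adjoin_sqrt)

lemma s_in_S: "s \<in> adjoin_sqrt L s"
  by (rule self_in_adjoin_sqrt)

text \<open>Exhibits \<open>x^2\<close> and \<open>y^2\<close> as conjugates under
  \<open>s \<mapsto> - s\<close>, so that conjugation can be carried out on coefficients, without
  automorphisms.\<close>

lemma x_y_sq_conjugate:
  obtains m n where "m \<in> L" "n \<in> L" "x\<^sup>2 = m + n * s" "y\<^sup>2 = m - n * s"
proof
  define m where "m = - a / 2"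
  define n where "n = a * c / (2 * s\<^sup>2)"
  show "m \<in> L" "n \<in> L"
    unfolding m_def n_def using a_in c_in s_sq_in by (auto intro!: closed_in)
  have "2 * m = - a" using two by (simp add: m_def)
  moreover have "2 * s * (n * s) = a * c"
    using two nonzero_roots(1) by (simp add: n_def power2_eq_square)
  ultimately have "2 * s * x\<^sup>2 = 2 * s * (m + n * s)" "2 * s * y\<^sup>2 = 2 * s * (m - n * s)"
    using sq_add sq_diff by Groebner_Basis.algebra+
  then show "x\<^sup>2 = m + n * s" "y\<^sup>2 = m - n * s"
    using two nonzero_roots(1) by simp_all
qed

lemma x_sq_in_if:
  assumes "closed_subfield E" "L \<subseteq> E" "s \<in> E"
  shows "x\<^sup>2 \<in> E"
proof -
  interpret E: closed_subfield E by fact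
  have "(2 * s) * x\<^sup>2 = - a * s + a * c" using sq_add sq_diff by Groebner_Basis.algebra
  then have "(2 * s) * x\<^sup>2 \<in> E" using assms a_in c_in by (auto intro!: E.closed_in)
  then show ?thesis
    by (rule E.mult_in_cancel) (use assms two nonzero_roots in \<open>auto intro!: E.closed_in\<close>)
qed

lemma x_sq_in_S: "x\<^sup>2 \<in> adjoin_sqrt L s"
  by (rule x_sq_in_if[OF S.closed_subfield_axioms L_subset_S s_in_S])

sublocale K: closed_subfield "root_field L s x"
  unfolding root_field_def by (rule S.closed_subfield_adjoin_sqrt[OF x_sq_in_S])

lemma S_subset_root_field: "adjoin_sqrt L s \<subseteq> root_field L s x"
  unfolding root_field_def by (rule S.subset_adjoin_sqrt)

lemma L_subset_root_field: "L \<subseteq> root_field L s x"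
  using L_subset_S S_subset_root_field by blast

lemma s_in_if:
  assumes "closed_subfield E" "L \<subseteq> E" "x \<in> E"
  shows "s \<in> E"
proof -
  interpret E: closed_subfield E by fact
  \<comment> \<open>The factor \<open>2 x^2 + a\<close> equals \<open>x^2 - y^2\<close>; it is
    nonzero because its product with \<open>s\<close> is \<open>a c\<close>.\<close>
  have e: "(2 * x\<^sup>2 + a) * s = a * c" using sq_add sq_diff by Groebner_Basis.algebra
  then have "(2 * x\<^sup>2 + a) * s \<in> E" using assms a_in c_in by (auto intro!: E.closed_in)
  then show ?thesis
    by (rule E.mult_in_cancel) (use e assms a_in nonzero in \<open>auto intro!: E.closed_in\<close>)
qed

lemma y_in_if:
  assumes "closed_subfield E" "L \<subseteq> E" "x \<in> E"
  shows "y \<in> E"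
proof -
  interpret E: closed_subfield E by fact
  have "(x * s) * y \<in> E" using xys a_in assms by (auto simp: ac_simps)
  then show ?thesis
    by (rule E.mult_in_cancel) (use assms nonzero_roots s_in_if in \<open>auto intro!: E.closed_in\<close>)
qed

lemma x_in_root_field: "x \<in> root_field L s x"
  unfolding root_field_def by (rule S.self_in_adjoin_sqrt)

lemma s_in_root_field: "s \<in> root_field L s x"
  using s_in_S S_subset_root_field by blast

lemma y_in_root_field: "y \<in> root_field L s x"
  by (rule y_in_if[OF K.closed_subfield_axioms L_subset_root_field x_in_root_field])

lemma root_field_least:
  assumes "closed_subfield E" "L \<subseteq> E" "x \<in> E"
  shows "root_field L s x \<subseteq> E"
  unfolding root_field_def
  by (intro S.adjoin_sqrt_least adjoin_sqrt_least assms s_in_if[OF assms])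

text \<open>If \<open>s \<notin> L\<close>, the conjugate \<open>u - v s\<close> of \<open>x = u + v s\<close> is \<open>\<plusminus>y\<close>, so the norm of \<open>x\<close> is \<open>\<plusminus>a / s\<close>.\<close>
lemma s_in_if_x_in_S:
  assumes "x \<in> adjoin_sqrt L s"
  shows "s \<in> L"
proof (rule ccontr)
  assume s: "s \<notin> L"
  obtain u v where x: "x = u + v * s" and uv: "u \<in> L" "v \<in> L"
    using assms unfolding adjoin_sqrt_def by blast
  have "(2 * s\<^sup>2 * (u\<^sup>2 + v\<^sup>2 * s\<^sup>2)) + (4 * s\<^sup>2 * u * v) * s = (- a * s\<^sup>2) + (a * c) * s"
    using sq_add sq_diff x by Groebner_Basis.algebra
  then have "2 * s\<^sup>2 * (u\<^sup>2 + v\<^sup>2 * s\<^sup>2) = - a * s\<^sup>2 \<and> 4 * s\<^sup>2 * u * v = a * c"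
    by (rule adjoin_sqrt_unique[OF s, rotated -1])
      (use uv s_sq_in a_in c_in in \<open>auto intro!: closed_in\<close>)
  then have e: "2 * s\<^sup>2 * (u\<^sup>2 + v\<^sup>2 * s\<^sup>2) = - a * s\<^sup>2" "4 * s\<^sup>2 * u * v = a * c"
    by auto
  \<comment> \<open>The square of the norm is \<open>(u^2 + v^2 s^2)^2 - (2 u v)^2 s^2\<close>,
    which \<open>s^2 - c^2 = 4\<close> turns into \<open>a^2 / s^2\<close>.\<close>
  have "4 * s\<^sup>2 * ((s * (u\<^sup>2 - v\<^sup>2 * s\<^sup>2))\<^sup>2 - a\<^sup>2) = 0"
    using e s_sq by Groebner_Basis.algebra
  moreover have "4 * s\<^sup>2 \<noteq> 0"
    using two nonzero_roots by (metis mult_eq_0_iff numeral_Bit0 mult_2 power_not_zero)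
  ultimately have "(s * (u\<^sup>2 - v\<^sup>2 * s\<^sup>2))\<^sup>2 = a\<^sup>2" by simp
  then have n: "(u\<^sup>2 - v\<^sup>2 * s\<^sup>2) * s = a \<or> (u\<^sup>2 - v\<^sup>2 * s\<^sup>2) * s = - a"
    by (auto simp: power2_eq_iff ac_simps)
  then have "(u\<^sup>2 - v\<^sup>2 * s\<^sup>2) * s \<in> L" using a_in uminus_in by metis
  then have "s \<in> L"
    by (rule mult_in_cancel) (use n nonzero uv s_sq_in in \<open>auto intro!: closed_in\<close>)
  with s show False ..
qed

text \<open>The relabelling by the Galois generator, available also when \<open>s \<in> L\<close>.
  Applied to the second quartic it turns \<open>x x' - y y'\<close> into
  \<open>x y' + y x'\<close>.\<close>

lemma rotate: "quartic_roots L a c (- s) y (- x)"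
  by unfold_locales (use two a_in c_in nonzero s_sq xys sq_add sq_diff in \<open>auto simp: algebra_simps\<close>)

text \<open>Changing the sign of \<open>c\<close> leaves \<open>f\<close> unchanged; done to the
  second quartic, it exchanges \<open>F\<^sup>+\<close> and \<open>F\<^sup>-\<close>.\<close>

lemma reflect: "quartic_roots L a (- c) (- s) x (- y)"
  by unfold_locales
    (use two a_in c_in nonzero s_sq xys sq_add sq_diff uminus_in in \<open>auto simp: algebra_simps\<close>)

end

section \<open>Resolvent roots in the base field give inclusions of splitting fields\<close>

lemma resolvent_product:
  assumes "quartic_roots L a c s x y" "quartic_roots L a' c' s' x' y'"
  shows "(x * x' - y * y') * (x * y' + y * x') * (s * s') = a * a' * (c + c')"
proof -
  interpret quartic_roots L a c s x y by fact
  interpret Q': quartic_roots L a' c' s' x' y' by fact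
  have "(x * x' - y * y') * (x * y' + y * x') * (s * s')
      = ((x\<^sup>2 - y\<^sup>2) * s) * (x' * y' * s') + (x * y * s) * ((x'\<^sup>2 - y'\<^sup>2) * s')"
    by Groebner_Basis.algebra
  then show ?thesis
    unfolding xys sq_diff Q'.xys Q'.sq_diff by (simp add: algebra_simps)
qed

text \<open>The field \<open>E\<close> receives first \<open>s'\<close>, then \<open>x'^2\<close>
  and \<open>x' y'\<close>, then \<open>x'\<close> on division by \<open>g\<close>. Here
  \<open>c c' \<noteq> 4\<close> makes the coefficient of \<open>s'\<close> nonzero, and
  \<open>c + c' \<noteq> 0\<close> makes \<open>g\<close> nonzero.\<close>

lemma root_in_if_resolvent_in:
  assumes "quartic_roots L a c s x y" "quartic_roots L a' c' s' x' y'"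
    and "closed_subfield E" "L \<subseteq> E" "x \<in> E"
    and g: "x * x' - y * y' \<in> L"
    and ne: "c + c' \<noteq> 0" "c * c' \<noteq> 4"
  shows "x' \<in> E"
proof -
  interpret quartic_roots L a c s x y by fact
  interpret Q': quartic_roots L a' c' s' x' y' by fact
  interpret E: closed_subfield E by fact
  let ?g = "x * x' - y * y'"
  have sE: "s \<in> E" and yE: "y \<in> E" using s_in_if y_in_if assms by auto
  \<comment> \<open>Rests on \<open>2 (x^2 x'^2 + y^2 y'^2) = (x^2 + y^2) (x'^2 + y'^2) + (x^2 -
    y^2) (x'^2 - y'^2)\<close>.\<close>
  have "(s * s') * (2 * ?g\<^sup>2 - a * a') = s * s' * ((x\<^sup>2 + y\<^sup>2) * (x'\<^sup>2 + y'\<^sup>2) - a * a')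
      + ((x\<^sup>2 - y\<^sup>2) * s) * ((x'\<^sup>2 - y'\<^sup>2) * s') - 4 * (x * y * s) * (x' * y' * s')"
    by Groebner_Basis.algebra
  then have "(s * s') * (2 * ?g\<^sup>2 - a * a') = a * a' * (c * c' - 4)"
    unfolding xys sq_add sq_diff Q'.xys Q'.sq_add Q'.sq_diff by (simp add: algebra_simps)
  then have e: "((2 * ?g\<^sup>2 - a * a') * s) * s' = a * a' * (c * c' - 4)"
    by (simp add: ac_simps)
  then have h: "((2 * ?g\<^sup>2 - a * a') * s) * s' \<in> E"
    using assms(4) a_in c_in Q'.a_in Q'.c_in by (auto intro!: E.closed_in)
  have "(2 * ?g\<^sup>2 - a * a') * s \<noteq> 0"
    using e nonzero Q'.nonzero ne by auto
  moreover have "2 * ?g\<^sup>2 - a * a' \<in> L"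
    by (intro diff_in mult_in power_in numeral_in g a_in Q'.a_in)
  then have "(2 * ?g\<^sup>2 - a * a') * s \<in> E"
    using assms(4) sE E.mult_in by blast
  ultimately have s'E: "s' \<in> E"
    using E.mult_in_cancel[OF h] by blast
  have x'2: "x'\<^sup>2 \<in> E" by (rule Q'.x_sq_in_if) (use assms s'E in auto)
  have "x' * y' * s' / s' \<in> E" unfolding Q'.xys using assms(4) Q'.a_in s'E by (auto intro!: E.closed_in)
  then have x'y': "x' * y' \<in> E" using Q'.nonzero_roots by simp
  have g0: "?g \<noteq> 0"
    using resolvent_product[OF assms(1,2)] ne nonzero Q'.nonzero by auto
  have "?g * x' = x * x'\<^sup>2 - y * (x' * y')" by Groebner_Basis.algebra
  then have "?g * x' \<in> E" using assms(5) yE x'2 x'y' by (auto intro!: E.closed_in)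
  then show ?thesis by (rule E.mult_in_cancel) (use g g0 assms(4) in auto)
qed

text \<open>One root from each pair of opposite roots: the first two belong to
  \<open>F\<^sup>+\<close>, the last two to \<open>F\<^sup>-\<close>.\<close>

definition resolvents :: "'a::field \<Rightarrow> 'a \<Rightarrow> 'a \<Rightarrow> 'a \<Rightarrow> 'a set" where
  "resolvents x y x' y' = {x * x' - y * y', x * y' + y * x', x * x' + y * y', x * y' - y * x'}"

lemma root_field_subset_if_resolvent_in:
  assumes Q: "quartic_roots L a c s x y" and Q': "quartic_roots L a' c' s' x' y'"
    and g: "resolvents x y x' y' \<inter> L \<noteq> {}"
    and ne: "c \<noteq> c'" "c \<noteq> - c'" "c * c' \<noteq> 4" "c * c' \<noteq> - 4"
  shows "root_field L s' x' \<subseteq> root_field L s x"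
proof -
  interpret quartic_roots L a c s x y by fact
  interpret Q': quartic_roots L a' c' s' x' y' by fact
  let ?E = "root_field L s x"
  have ne': "c + c' \<noteq> 0" "c + - c' \<noteq> 0" "c * - c' \<noteq> 4"
    using ne by (auto simp: eq_neg_iff_add_eq_0 minus_equation_iff[of "c * c'"])
  note E = K.closed_subfield_axioms L_subset_root_field x_in_root_field
  note I = root_in_if_resolvent_in[OF Q _ E]
  \<comment> \<open>Up to sign, each resolvent is \<open>x X - y Y\<close>, where
    \<open>(X, Y)\<close> is \<open>(x', y')\<close> left alone, rotated, reflected, or reflected
    and then rotated.\<close>
  from g consider "x * x' - y * y' \<in> L" | "x * y' - y * (- x') \<in> L" | "x * x' - y * (- y') \<in> L"
    | "x * (- y') - y * (- x') \<in> L"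
    unfolding resolvents_def using uminus_in[of "x * y' - y * x'"] by auto
  then have "x' \<in> ?E"
  proof cases
    case 1
    show ?thesis by (rule I[OF Q']) (use 1 ne ne' in auto)
  next
    case 2
    have "y' \<in> ?E" by (rule I[OF Q'.rotate]) (use 2 ne ne' in auto)
    then have "- x' \<in> ?E" using quartic_roots.y_in_if[OF Q'.rotate] E by blast
    then show ?thesis by (simp add: K.uminus_in_iff)
  next
    case 3
    show ?thesis by (rule I[OF Q'.reflect]) (use 3 ne' in auto)
  next
    case 4
    have "- y' \<in> ?E"
      by (rule I[OF quartic_roots.rotate[OF Q'.reflect]]) (use 4 ne' in auto)
    then have "- x' \<in> ?E" 
      using quartic_roots.y_in_if[OF quartic_roots.rotate[OF Q'.reflect]] E by blast
    then show ?thesis by (simp add: K.uminus_in_iff)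
  qed
  then show ?thesis by (rule Q'.root_field_least[OF E(1,2)])
qed

text \<open>Exchanging the quartics only changes the sign of \<open>x y' - y x'\<close>.\<close>

lemma resolvents_commute:
  assumes "closed_subfield L"
  shows "resolvents x y x' y' \<inter> L \<noteq> {} \<longleftrightarrow> resolvents x' y' x y \<inter> L \<noteq> {}"
proof -
  interpret closed_subfield L by fact
  show ?thesis
    using uminus_in_iff[of "x * y' - y * x'"] by (auto simp: resolvents_def ac_simps)
qed

section \<open>Equal splitting fields give a resolvent root in the base field\<close>

lemma s_in_transfer:
  assumes Q: "quartic_roots L a c s x y" and Q': "quartic_roots L a' c' s' x' y'"
    and eq: "root_field L s x = root_field L s' x'" and s: "s \<in> L"
  shows "s' \<in> L"
proof (rule ccontr)
  assume s': "s' \<notin> L"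
  interpret quartic_roots L a c s x y by fact
  interpret Q': quartic_roots L a' c' s' x' y' by fact
  \<comment> \<open>The common field is \<open>L(x)\<close>, at most quadratic over
    \<open>L\<close>, and it contains \<open>s'\<close>. Hence it equals \<open>L(s')\<close>, so
    \<open>x' \<in> L(s')\<close>, which forces \<open>s' \<in> L\<close>.\<close>
  have S: "adjoin_sqrt L s = L" by (rule adjoin_sqrt_trivial[OF s])
  have K: "root_field L s x = adjoin_sqrt L x" by (simp add: root_field_def S)
  have "x \<notin> L"
    using s' Q'.s_in_root_field K eq adjoin_sqrt_trivial by metis
  then obtain q where q: "q \<in> L" "q \<noteq> 0" "s' = q * x"
    using kummer_sqrt[OF two _ _ _ _ s'] x_sq_in_S Q'.s_in_root_field Q'.s_sq_in
    unfolding S eq[symmetric] K by blast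
  have "x \<in> adjoin_sqrt L s'"
    by (rule Q'.S.mult_in_cancel[of q]) (use q Q'.s_in_S Q'.L_subset_S in auto)
  then have "root_field L s x \<subseteq> adjoin_sqrt L s'"
    by (rule root_field_least[OF Q'.S.closed_subfield_axioms Q'.L_subset_S])
  then have "x' \<in> adjoin_sqrt L s'" using eq Q'.x_in_root_field by blast
  then show False using Q'.s_in_if_x_in_S s' by blast
qed

lemma resolvent_in_if_root_field_eq:
  assumes Q: "quartic_roots L a c s x y" and Q': "quartic_roots L a' c' s' x' y'"
    and eq: "root_field L s x = root_field L s' x'"
  shows "resolvents x y x' y' \<inter> L \<noteq> {}"
proof -
  interpret quartic_roots L a c s x y by fact
  interpret Q': quartic_roots L a' c' s' x' y' by fact
  show ?thesis
  proof (cases "s \<in> L")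
    case s: True
    then have s': "s' \<in> L" using s_in_transfer[OF Q Q' eq] by blast
    have S: "adjoin_sqrt L s = L" "adjoin_sqrt L s' = L"
      using adjoin_sqrt_trivial s s' by auto
    then have K: "root_field L s x = adjoin_sqrt L x" "root_field L s' x' = adjoin_sqrt L x'"
      by (auto simp: root_field_def)
    \<comment> \<open>If \<open>x' \<notin> L\<close>, then \<open>x\<close> and \<open>x'\<close>
      are square roots of elements of \<open>L\<close> generating the same quadratic extension, so
      \<open>x' = q x\<close> with \<open>q \<in> L\<close>.\<close>
    have "x * x' \<in> L"
    proof (cases "x' \<in> L")
      case True
      then have "x \<in> L"
        using x_in_root_field K eq adjoin_sqrt_trivial by metis
      then show ?thesis using True by (simp add: mult_in)
    next
      case x': False
      then have "x \<notin> L"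
        using Q'.x_in_root_field K eq adjoin_sqrt_trivial by metis
      then obtain q where q: "q \<in> L" "x' = q * x"
        using kummer_sqrt[OF two _ _ _ _ x'] x_sq_in_S Q'.x_sq_in_S Q'.x_in_root_field
        unfolding S eq[symmetric] K by blast
      have "q * x\<^sup>2 \<in> L" using q x_sq_in_S S by (simp add: mult_in)
      then show ?thesis using q by (simp add: power2_eq_square ac_simps)
    qed
    moreover have "y * y' \<in> L"
    proof (rule mult_in_cancel)
      have "(s * s' * (x * x')) * (y * y') = a * a'"
        unfolding xys[symmetric] Q'.xys[symmetric] by (simp add: ac_simps)
      then show "(s * s' * (x * x')) * (y * y') \<in> L" using a_in Q'.a_in by (simp add: mult_in)
    qed (use calculation s s' nonzero_roots Q'.nonzero_roots in \<open>auto intro: mult_in\<close>)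
    ultimately show ?thesis unfolding resolvents_def using diff_in by blast
  next
    case s: False
    then have s': "s' \<notin> L" using s_in_transfer[OF Q' Q] eq by auto
    have xS: "x \<notin> adjoin_sqrt L s" and x'S: "x' \<notin> adjoin_sqrt L s'"
      using s_in_if_x_in_S Q'.s_in_if_x_in_S s s' by auto
    \<comment> \<open>A cyclic extension of degree 4 has only one quadratic subextension.
      Concretely, if \<open>s' = q x\<close> with \<open>q = u + v s\<close>, conjugating the square
      gives \<open>s'^2 = (u - v s)^2 y^2\<close>. The product of both equations, with
      \<open>x y = a / s\<close>, puts \<open>s\<close> into \<open>L\<close>.\<close>
    have s'S: "s' \<in> adjoin_sqrt L s"
    proof (rule ccontr)
      assume ns': "s' \<notin> adjoin_sqrt L s"
      have "s' \<in> adjoin_sqrt (adjoin_sqrt L s) x"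
        using Q'.s_in_root_field unfolding eq[symmetric] unfolding root_field_def .
      moreover have "s'\<^sup>2 \<in> adjoin_sqrt L s" using Q'.s_sq_in L_subset_S by blast
      ultimately obtain q where q: "q \<in> adjoin_sqrt L s" "s' = q * x"
        using S.kummer_sqrt[OF two x_sq_in_S xS _ _ ns'] by blast
      obtain u v where uv: "q = u + v * s" "u \<in> L" "v \<in> L"
        using q(1) unfolding adjoin_sqrt_def by blast
      obtain m n where mn: "m \<in> L" "n \<in> L" "x\<^sup>2 = m + n * s" "y\<^sup>2 = m - n * s"
        by (rule x_y_sq_conjugate)
      let ?A = "u\<^sup>2 + v\<^sup>2 * s\<^sup>2" and ?B = "2 * u * v"
      \<comment> \<open>Comparing the coefficients of \<open>1\<close> and \<open>s\<close> in
        \<open>q^2 x^2 = s'^2\<close> takes the place of applying the conjugation.\<close>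
      have "(?A * m + ?B * n * s\<^sup>2) + (?A * n + ?B * m) * s = s'\<^sup>2 + 0 * s"
        using q(2) uv(1) mn(3) by Groebner_Basis.algebra
      then have "?A * m + ?B * n * s\<^sup>2 = s'\<^sup>2 \<and> ?A * n + ?B * m = 0"
        by (rule adjoin_sqrt_unique[OF s, rotated -1])
          (use uv mn s_sq_in Q'.s_sq_in in \<open>auto intro!: closed_in\<close>)
      then have "?A * m + ?B * n * s\<^sup>2 = s'\<^sup>2" "?A * n + ?B * m = 0"
        by auto
      then have conj: "(u - v * s)\<^sup>2 * y\<^sup>2 = s'\<^sup>2"
        unfolding mn(4) by Groebner_Basis.algebra
      have "(s'\<^sup>2 * s)\<^sup>2 = ((u\<^sup>2 - v\<^sup>2 * s\<^sup>2) * a)\<^sup>2"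
        using conj q(2) uv(1) xys by Groebner_Basis.algebra
      then have "s'\<^sup>2 * s = (u\<^sup>2 - v\<^sup>2 * s\<^sup>2) * a \<or> s'\<^sup>2 * s = - ((u\<^sup>2 - v\<^sup>2 * s\<^sup>2) * a)"
        by (auto simp: power2_eq_iff)
      moreover have "(u\<^sup>2 - v\<^sup>2 * s\<^sup>2) * a \<in> L"
        using uv s_sq_in a_in by (auto intro!: closed_in)
      ultimately have "s'\<^sup>2 * s \<in> L" using uminus_in by metis
      then have "s \<in> L" 
        by (rule mult_in_cancel) (use Q'.s_sq_in Q'.nonzero_roots in auto)
      with s show False ..
    qed
    then obtain r where r: "r \<in> L" "r \<noteq> 0" "s' = r * s"
      using kummer_sqrt[OF two s_sq_in s s'S Q'.s_sq_in s'] by blast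
    have s_s': "s \<in> adjoin_sqrt L s'"
      by (rule Q'.S.mult_in_cancel[of r]) (use r Q'.s_in_S Q'.L_subset_S in auto)
    have SS: "adjoin_sqrt L s' = adjoin_sqrt L s"
      using adjoin_sqrt_least[OF S.closed_subfield_axioms L_subset_S s'S]
        adjoin_sqrt_least[OF Q'.S.closed_subfield_axioms Q'.L_subset_S s_s'] by blast
    have "x' \<in> adjoin_sqrt (adjoin_sqrt L s) x"
      using Q'.x_in_root_field unfolding eq[symmetric] unfolding root_field_def .
    then obtain q where q: "q \<in> adjoin_sqrt L s" "x' = q * x"
      using S.kummer_sqrt[OF two x_sq_in_S xS _ Q'.x_sq_in_S[unfolded SS] x'S[unfolded SS]] by blast
    obtain u v where uv: "q = u + v * s" "u \<in> L" "v \<in> L"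
      using q(1) unfolding adjoin_sqrt_def by blast
    obtain m n where mn: "m \<in> L" "n \<in> L" "x\<^sup>2 = m + n * s" "y\<^sup>2 = m - n * s"
      by (rule x_y_sq_conjugate)
    obtain m' n' where mn': "m' \<in> L" "n' \<in> L" "x'\<^sup>2 = m' + n' * s'" "y'\<^sup>2 = m' - n' * s'"
      by (rule Q'.x_y_sq_conjugate)
    let ?A = "u\<^sup>2 + v\<^sup>2 * s\<^sup>2" and ?B = "2 * u * v"
    \<comment> \<open>With \<open>s' = r s\<close>, comparing coefficients in
      \<open>x'^2 = q^2 x^2\<close> yields the conjugate equation
      \<open>y'^2 = (u - v s)^2 y^2\<close>.\<close>
    have "(?A * m + ?B * n * s\<^sup>2) + (?A * n + ?B * m) * s = m' + (n' * r) * s"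
      using q(2) uv(1) r(3) mn(3) mn'(3) by Groebner_Basis.algebra
    then have "?A * m + ?B * n * s\<^sup>2 = m' \<and> ?A * n + ?B * m = n' * r"
      by (rule adjoin_sqrt_unique[OF s, rotated -1])
        (use uv mn mn' r s_sq_in in \<open>auto intro!: closed_in\<close>)
    then have e: "?A * m + ?B * n * s\<^sup>2 = m'" "?A * n + ?B * m = n' * r"
      by auto
    have "y'\<^sup>2 = m' - (n' * r) * s"
      unfolding mn'(4) r(3) by (simp add: mult.assoc)
    also have "\<dots> = ((u - v * s) * y)\<^sup>2"
      unfolding e[symmetric] power_mult_distrib mn(4) by Groebner_Basis.algebra
    finally consider "y' = (u - v * s) * y" | "y' = - ((u - v * s) * y)"
      unfolding power2_eq_iff by blast
    then show ?thesis
    proof cases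
      case 1
      \<comment> \<open>This is the trace of \<open>q x^2\<close> from \<open>L(s)\<close> to
        \<open>L\<close>. The sign of \<open>y'\<close> decides whether it is a root of
        \<open>F\<^sup>-\<close>, as here, or of \<open>F\<^sup>+\<close>.\<close>
      have "x * x' + y * y' = u * (x\<^sup>2 + y\<^sup>2) + v * ((x\<^sup>2 - y\<^sup>2) * s)"
        using 1 q uv by Groebner_Basis.algebra
      then have "x * x' + y * y' \<in> L"
        unfolding sq_add sq_diff using uv a_in c_in by (auto intro!: closed_in)
      then show ?thesis unfolding resolvents_def by blast
    next
      case 2
      have "x * x' - y * y' = u * (x\<^sup>2 + y\<^sup>2) + v * ((x\<^sup>2 - y\<^sup>2) * s)"
        using 2 q uv by Groebner_Basis.algebra
      then have "x * x' - y * y' \<in> L"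
        unfolding sq_add sq_diff using uv a_in c_in by (auto intro!: closed_in)
      then show ?thesis unfolding resolvents_def by blast
    qed
  qed
qed

section \<open>The quartics over the algebraic closure\<close>

lemma quartic_eq_0_iff:
  fixes u v z :: "'a::field"
  shows "poly [:u\<^sup>2 * v\<^sup>2, 0, - (u\<^sup>2 + v\<^sup>2), 0, 1:] z = 0 \<longleftrightarrow> z \<in> {u, - u, v, - v}"
proof -
  have "poly [:u\<^sup>2 * v\<^sup>2, 0, - (u\<^sup>2 + v\<^sup>2), 0, 1:] z = (z\<^sup>2 - u\<^sup>2) * (z\<^sup>2 - v\<^sup>2)"
    by (simp add: algebra_simps power2_eq_square)
  then show ?thesis by (auto simp: power2_eq_iff)
qed

lemma closed_subfield_range_to_ac: "closed_subfield (range (to_ac :: 'm::field \<Rightarrow> _))"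
proof
  show "1 \<in> range (to_ac :: 'm \<Rightarrow> _)" by (metis rangeI to_ac_1)
  fix u v :: "'m alg_closure"
  assume "u \<in> range to_ac"
  then obtain p where u: "u = to_ac p" by blast
  show "- u \<in> range to_ac" "inverse u \<in> range to_ac"
    unfolding u to_ac_minus[symmetric] to_ac_inverse[symmetric] by blast+
  assume "v \<in> range to_ac"
  then obtain q where v: "v = to_ac q" by blast
  show "u + v \<in> range to_ac" "u * v \<in> range to_ac"
    unfolding u v to_ac_add[symmetric] to_ac_mult[symmetric] by blast+
qed

lemma sqrt_exists_alg_closed: "\<exists>w::'a::alg_closed_field. w\<^sup>2 = z"
  using alg_closed_imp_poly_has_root[of "[:- z, 0, 1:]"] by (auto simp: power2_eq_square)

lemma quartic_roots_exist:
  fixes a c :: "'m::field"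
  assumes two: "(2::'m) \<noteq> 0" and nz: "a \<noteq> 0" "c \<noteq> 0" "c\<^sup>2 + 4 \<noteq> 0"
  obtains s x y where "quartic_roots (range to_ac) (to_ac a) (to_ac c) s x y"
proof -
  interpret closed_subfield "range to_ac :: 'm alg_closure set"
    by (rule closed_subfield_range_to_ac)
  let ?a = "to_ac a" and ?c = "to_ac c"
  have two': "(2 :: 'm alg_closure) \<noteq> 0"
    using two by (metis to_ac_eq_0_iff to_ac_numeral)
  obtain s where s: "s\<^sup>2 = ?c\<^sup>2 + 4"
    using sqrt_exists_alg_closed by blast
  have "to_ac (c\<^sup>2 + 4) \<noteq> 0" using nz(3) by (simp only: to_ac_eq_0_iff not_False_eq_True)
  then have "s\<^sup>2 \<noteq> 0" using s by simp
  then have s0: "s \<noteq> 0" by auto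
  \<comment> \<open>The value of \<open>x^2\<close> comes from solving \<open>sq_add\<close> and
    \<open>sq_diff\<close> for it.\<close>
  obtain x where x: "x\<^sup>2 = ?a * (?c - s) / (2 * s)"
    using sqrt_exists_alg_closed by blast
  \<comment> \<open>This keeps \<open>x\<close> nonzero, so that \<open>y\<close> can be defined by
    division.\<close>
  have "(s - ?c) * (s + ?c) = 2 * 2" using s by Groebner_Basis.algebra
  moreover have "2 * 2 \<noteq> (0 :: 'm alg_closure)" using two' by (simp only: mult_eq_0_iff simp_thms)
  ultimately have "s - ?c \<noteq> 0" by (metis mult_zero_left)
  then have x0: "x \<noteq> 0" using x s0 two' nz(1) by auto
  have xs: "x\<^sup>2 * (2 * s) = ?a * (?c - s)" using x s0 two' by simp
  define y where "y = ?a / (x * s)"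
  have xys: "x * y * s = ?a" using x0 s0 by (simp add: y_def)
  \<comment> \<open>The factor \<open>4 s^2 x^2\<close> makes \<open>y\<close> enter only through
    \<open>x y s\<close>, and \<open>x\<close> otherwise only through
    \<open>2 s x^2\<close>.\<close>
  have "2 * 2 * s\<^sup>2 * x\<^sup>2 * (y\<^sup>2 + x\<^sup>2 + ?a)
      = 4 * (x * y * s)\<^sup>2 + (x\<^sup>2 * (2 * s)) * (x\<^sup>2 * (2 * s) + 2 * s * ?a)"
    by Groebner_Basis.algebra
  also have "\<dots> = ?a\<^sup>2 * (4 + ?c\<^sup>2 - s\<^sup>2)"
    unfolding xs xys by Groebner_Basis.algebra
  finally have "2 * 2 * s\<^sup>2 * x\<^sup>2 * (y\<^sup>2 + x\<^sup>2 + ?a) = 0"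
    using s by simp
  then have "y\<^sup>2 + x\<^sup>2 + ?a = 0"
    unfolding mult_eq_0_iff using two' s0 x0 by simp
  then have sq_add: "x\<^sup>2 + y\<^sup>2 = - ?a" by Groebner_Basis.algebra
  have "(x\<^sup>2 - y\<^sup>2) * s = ?a * ?c" using sq_add xs by Groebner_Basis.algebra
  with s xys sq_add two' nz have "quartic_roots (range to_ac) ?a ?c s x y"
    by unfold_locales auto
  then show ?thesis by (rule that)
qed

text \<open>A field over \<open>M\<close> containing the root \<open>x\<close> contains
  \<open>s\<close> and hence \<open>y\<close>, so adjoining all four roots amounts to adjoining
  \<open>x\<close>.\<close>

lemma splitting_field_quartic_f:
  assumes "quartic_roots (range to_ac) (to_ac a) (to_ac c) s x y"
  shows "splitting_field (quartic_f a c) = root_field (range to_ac) s x"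
proof -
  interpret quartic_roots "range to_ac" "to_ac a" "to_ac c" s x y by fact
  have "(x * y)\<^sup>2 * s\<^sup>2 = (to_ac a)\<^sup>2"
    unfolding xys[symmetric] by Groebner_Basis.algebra
  then have "(to_ac a)\<^sup>2 / s\<^sup>2 = x\<^sup>2 * y\<^sup>2"
    using nonzero_roots by (simp add: field_simps)
  moreover have "map_poly to_ac (quartic_f a c) = [:(to_ac a)\<^sup>2 / s\<^sup>2, 0, to_ac a, 0, 1:]"
    by (simp add: quartic_f_def map_poly_pCons s_sq)
  ultimately have "map_poly to_ac (quartic_f a c) = [:x\<^sup>2 * y\<^sup>2, 0, - (x\<^sup>2 + y\<^sup>2), 0, 1:]"
    by (simp add: sq_add)
  then have roots: "{z. poly (map_poly to_ac (quartic_f a c)) z = 0} = {x, - x, y, - y}"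
    using quartic_eq_0_iff[of x y] by auto
  show ?thesis
    unfolding splitting_field_def roots
  proof (rule generate_field_eqI)
    show "range to_ac \<union> {x, - x, y, - y} \<subseteq> root_field (range to_ac) s x"
      using L_subset_root_field x_in_root_field y_in_root_field K.uminus_in by auto
  qed (use K.closed_subfield_axioms root_field_least in auto)
qed

section \<open>Linear factors of the resolvent quartics\<close>

lemma has_linear_factor_iff: "has_linear_factor p \<longleftrightarrow> (\<exists>z. poly p z = 0)"
proof
  assume "has_linear_factor p"
  then obtain q where q: "Polynomial.degree q = 1" "q dvd p" by (auto simp: has_linear_factor_def)
  obtain u v where uv: "q = [:u, v:]" "v \<noteq> 0"
    using degree1_coeffs[OF q(1)] by blast
  then have "poly q (- u / v) = 0" by simp
  then show "\<exists>z. poly p z = 0" using q(2) by (metis dvd_trans poly_eq_0_iff_dvd)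
next
  assume "\<exists>z. poly p z = 0"
  then obtain z where "[:- z, 1:] dvd p" by (auto simp: poly_eq_0_iff_dvd)
  then show "has_linear_factor p"
    unfolding has_linear_factor_def by (intro exI[of _ "[:- z, 1:]"]) simp
qed

lemma poly_map_poly_to_ac: "poly (map_poly to_ac p) (to_ac z) = to_ac (poly p z)"
  by (induction p) (simp_all add: map_poly_pCons)

lemma has_linear_factor_iff_quartic:
  fixes p :: "'m::field poly"
  assumes "map_poly to_ac p = [:u\<^sup>2 * v\<^sup>2, 0, - (u\<^sup>2 + v\<^sup>2), 0, 1:]"
  shows "has_linear_factor p \<longleftrightarrow> {u, v} \<inter> range to_ac \<noteq> {}"
proof -
  interpret closed_subfield "range to_ac :: 'm alg_closure set"
    by (rule closed_subfield_range_to_ac)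
  have "poly p z = 0 \<longleftrightarrow> poly (map_poly to_ac p) (to_ac z) = 0" for z
    by (simp add: poly_map_poly_to_ac)
  then have "has_linear_factor p \<longleftrightarrow> (\<exists>z. to_ac z \<in> {u, - u, v, - v})"
    unfolding has_linear_factor_iff assms quartic_eq_0_iff by simp
  moreover have "(\<exists>z. to_ac z \<in> S) \<longleftrightarrow> S \<inter> range (to_ac :: 'm \<Rightarrow> _) \<noteq> {}" for S
    by blast
  moreover have "{u, - u, v, - v} \<inter> range to_ac \<noteq> {} \<longleftrightarrow> {u, v} \<inter> range to_ac \<noteq> {}"
    using uminus_in_iff[of u] uminus_in_iff[of v] by (simp only: Int_insert_left) simp
  ultimately show ?thesis by metis
qed

lemma has_linear_factor_F_plus_iff:
  assumes "quartic_roots (range to_ac) (to_ac a) (to_ac c) s x y"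
    and "quartic_roots (range to_ac) (to_ac a') (to_ac c') s' x' y'"
  shows "has_linear_factor (F_plus a c a' c') \<longleftrightarrow>
    {x * x' - y * y', x * y' + y * x'} \<inter> range to_ac \<noteq> {}" (is "_ \<longleftrightarrow> {?u, ?v} \<inter> _ \<noteq> _")
proof (rule has_linear_factor_iff_quartic)
  interpret quartic_roots "range to_ac" "to_ac a" "to_ac c" s x y by fact
  interpret Q': quartic_roots "range to_ac" "to_ac a'" "to_ac c'" s' x' y' by fact
  have "(?u * ?v)\<^sup>2 * (s\<^sup>2 * s'\<^sup>2) = (to_ac a)\<^sup>2 * (to_ac a')\<^sup>2 * (to_ac c + to_ac c')\<^sup>2"
    unfolding power_mult_distrib[symmetric] resolvent_product[OF assms, symmetric] ..
  then have "(to_ac a)\<^sup>2 * (to_ac a')\<^sup>2 * (to_ac c + to_ac c')\<^sup>2 / (s\<^sup>2 * s'\<^sup>2) = ?u\<^sup>2 * ?v\<^sup>2"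
    using nonzero_roots Q'.nonzero_roots by (simp add: nonzero_divide_eq_eq power_mult_distrib)
  \<comment> \<open>The sum of squares factors as \<open>(x^2 + y^2) (x'^2 + y'^2)\<close>.\<close>
  moreover have "to_ac a * to_ac a' = ?u\<^sup>2 + ?v\<^sup>2"
    using sq_add Q'.sq_add by Groebner_Basis.algebra
  moreover have "map_poly to_ac (F_plus a c a' c') =
    [:(to_ac a)\<^sup>2 * (to_ac a')\<^sup>2 * (to_ac c + to_ac c')\<^sup>2 / (s\<^sup>2 * s'\<^sup>2), 0, - (to_ac a * to_ac a'), 0, 1:]"
    by (simp add: F_plus_def map_poly_pCons s_sq Q'.s_sq)
  ultimately show "map_poly to_ac (F_plus a c a' c') = [:?u\<^sup>2 * ?v\<^sup>2, 0, - (?u\<^sup>2 + ?v\<^sup>2), 0, 1:]"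
    by simp
qed

text \<open>Negating \<open>c'\<close> turns \<open>F\<^sup>+\<close> into \<open>F\<^sup>-\<close>,
  so reflecting the second quartic reduces this to the case of \<open>F\<^sup>+\<close>.\<close>

lemma has_linear_factor_F_minus_iff:
  assumes "quartic_roots (range to_ac) (to_ac a) (to_ac c) s x y"
    and "quartic_roots (range to_ac) (to_ac a') (to_ac c') s' x' y'"
  shows "has_linear_factor (F_minus a c a' c') \<longleftrightarrow>
    {x * x' + y * y', x * y' - y * x'} \<inter> range to_ac \<noteq> {}"
proof -
  interpret Q': quartic_roots "range to_ac" "to_ac a'" "to_ac c'" s' x' y' by fact
  have "quartic_roots (range to_ac) (to_ac a') (to_ac (- c')) (- s') x' (- y')"
    using Q'.reflect by simp
  from has_linear_factor_F_plus_iff[OF assms(1) this]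
  have "has_linear_factor (F_minus a c a' c') \<longleftrightarrow>
    {x * x' + y * y', - (x * y' - y * x')} \<inter> range to_ac \<noteq> {}"
    by (simp add: F_plus_def F_minus_def algebra_simps)
  then show ?thesis using Q'.uminus_in_iff[of "x * y' - y * x'"] by auto
qed

section \<open>The characteristic of \<open>M\<close> and the final equivalence\<close>

lemma two_neq_zero_if_ring_hom:
  fixes \<iota> :: "'k::field \<Rightarrow> 'm::field"
  assumes "CHAR('k) \<noteq> 2"
    and "\<iota> \<in> ring_hom ring_of_type_algebra ring_of_type_algebra"
  shows "(2::'m) \<noteq> 0"
proof
  assume m: "(2::'m) = 0"
  have hom: "\<iota> (u * v) = \<iota> u * \<iota> v" "\<iota> (u + v) = \<iota> u + \<iota> v" "\<iota> 1 = 1" for u v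
    using assms(2) by (auto simp: ring_hom_def ring_of_type_algebra_def)
  have "\<iota> 2 = 0" using hom(2)[of 1 1] hom(3) m by simp
  have "(2::'k) = 0"
  proof (rule ccontr)
    \<comment> \<open>An inverse of 2 in \<open>k\<close> would be mapped to an inverse of
      \<open>\<iota> 2 = 0\<close>.\<close>
    assume "(2::'k) \<noteq> 0"
    then have "\<iota> 2 * \<iota> (1 / 2) = 1" unfolding hom(1)[symmetric] using hom(3) by simp
    with \<open>\<iota> 2 = 0\<close> show False by simp
  qed
  then have "CHAR('k) dvd 2" by (metis of_nat_eq_0_iff_char_dvd of_nat_numeral)
  then have "CHAR('k) = 1 \<or> CHAR('k) = 2" using two_is_prime_nat prime_nat_iff by blast
  then show False using assms(1) by simp
qed

theorem theorem5p1:
  fixes \<iota> :: "'k::field \<Rightarrow> 'm::field"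
    and a c a' c' :: 'm
  assumes "CHAR('k) \<noteq> 2"
    and "\<iota> \<in> ring_hom ring_of_type_algebra ring_of_type_algebra"
    and "infinite (UNIV :: 'm set)"
    and "a * a' * c * c' * (c\<^sup>2 + 4) * (c'\<^sup>2 + 4) \<noteq> 0"
    and "c \<noteq> c'" and "c \<noteq> - c'"
    and "c \<noteq> 4 / c'" and "c \<noteq> - (4 / c')"
  shows "splitting_field (quartic_f a c) = splitting_field (quartic_f a' c') \<longleftrightarrow>
         has_linear_factor (F_plus a c a' c') \<or> has_linear_factor (F_minus a c a' c')"
proof -
  let ?L = "range (to_ac :: 'm \<Rightarrow> _)"
  have two: "(2::'m) \<noteq> 0" using two_neq_zero_if_ring_hom assms(1,2) by blast
  have nz: "a \<noteq> 0" "c \<noteq> 0" "c\<^sup>2 + 4 \<noteq> 0" "a' \<noteq> 0" "c' \<noteq> 0" "c'\<^sup>2 + 4 \<noteq> 0"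
    using assms(4) by auto
  obtain s x y where Q: "quartic_roots ?L (to_ac a) (to_ac c) s x y"
    using quartic_roots_exist[OF two nz(1-3)] .
  obtain s' x' y' where Q': "quartic_roots ?L (to_ac a') (to_ac c') s' x' y'"
    using quartic_roots_exist[OF two nz(4-6)] .
  have "c * c' \<noteq> 4" "c * c' \<noteq> - 4"
    using assms(7,8) nz(5) by (auto simp: field_simps)
  then have "to_ac (c * c') \<noteq> to_ac 4" "to_ac (c * c') \<noteq> to_ac (- 4)"
    "to_ac c \<noteq> to_ac c'" "to_ac c \<noteq> to_ac (- c')"
    using assms(5,6) by (simp_all only: to_ac_eq_iff not_False_eq_True)
  then have ne: "to_ac c \<noteq> to_ac c'" "to_ac c \<noteq> - to_ac c'"
    "to_ac c * to_ac c' \<noteq> 4" "to_ac c * to_ac c' \<noteq> - 4"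
    by simp_all
  then have ne': "to_ac c' \<noteq> to_ac c" "to_ac c' \<noteq> - to_ac c"
    "to_ac c' * to_ac c \<noteq> 4" "to_ac c' * to_ac c \<noteq> - 4"
    by (auto simp: ac_simps)
  note comm = resolvents_commute[OF closed_subfield_range_to_ac, of x y x' y']
  have "splitting_field (quartic_f a c) = splitting_field (quartic_f a' c') \<longleftrightarrow>
    root_field ?L s x = root_field ?L s' x'"
    by (simp only: splitting_field_quartic_f[OF Q] splitting_field_quartic_f[OF Q'])
  \<comment> \<open>From right to left, the inclusion is applied twice, the second time with the
    quartics exchanged.\<close>
  also have "\<dots> \<longleftrightarrow> resolvents x y x' y' \<inter> ?L \<noteq> {}"
    using resolvent_in_if_root_field_eq[OF Q Q'] root_field_subset_if_resolvent_in[OF Q Q' _ ne]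
      root_field_subset_if_resolvent_in[OF Q' Q _ ne'] comm by blast
  also have "\<dots> \<longleftrightarrow> has_linear_factor (F_plus a c a' c') \<or> has_linear_factor (F_minus a c a' c')"
    unfolding has_linear_factor_F_plus_iff[OF Q Q'] has_linear_factor_F_minus_iff[OF Q Q']
      resolvents_def by blast
  finally show ?thesis .
qed

end
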